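(* For real $x>1$ put $L_1=\ln x$, $L_2=\ln\ln x$, $\sigma=1/L_1$, $\tau=L_2/L_1$, $L_\tau=\ln(1-\tau)$ and $\eta=\sigma/(1-\tau)$. Then, for all sufficiently large $x$, the series (in $m$) below converges and $$ W(x) = L_1 - L_2 - L_\tau + \sum_{m\ge 1}\frac{1}{m!} L_\tau^m \eta^m \sum_{p=0}^{m-1}(-1)^{p+m-1}{ p+m-1 \brace p}_{\ge 2} \frac{1}{(1+\eta)^{p+m}}. $$
   Context: For $x>0$, $W(x)$ denotes the unique positive real solution $y$ of $y e^y=x$ (the Lambert $W$ function). The 2-associated Stirling subset numbers ${n\brace m}_{\ge 2}$ are defined by $$(e^z-1-z)^m=m!\sum_n{n\brace m}_{\ge 2}\frac{z^n}{n!};$$ in particular ${0\brace 0}_{\ge 2}=1$ and ${n\brace 0}_{\ge 2}=0$ for $n\ge 1$. For $x>1$ one has $L_2<L_1$, so $1-\tau>0$ and $L_\tau$, $\eta$ are well defined. *)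

theory Defs
  imports Complex_Main "HOL-Computational_Algebra.Formal_Power_Series"
begin

definition lambertW :: "real \<Rightarrow> real" where
  "lambertW x = (THE y. 0 < y \<and> y * exp y = x)"

text \<open>
  The 2-associated Stirling subset numbers, read off from the coefficients of their
  generating function \<open>(exp z - 1 - z) ^ m\<close>, as real numbers.
\<close>
definition assoc_stirling2 :: "nat \<Rightarrow> nat \<Rightarrow> real" where
  "assoc_stirling2 n m =
     fact n / fact m * fps_nth ((fps_exp (1::real) - 1 - fps_X) ^ m) n"

lemma assoc_stirling2_egf:
  "(fps_exp (1::real) - 1 - fps_X) ^ m =
     fps_const (fact m) * Abs_fps (\<lambda>n. assoc_stirling2 n m / fact n)"
  by (rule fps_ext) (simp add: assoc_stirling2_def)

lemma assoc_stirling2_0_0: "assoc_stirling2 0 0 = 1"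
  by (simp add: assoc_stirling2_def)

lemma assoc_stirling2_pos_0: "n \<ge> 1 \<Longrightarrow> assoc_stirling2 n 0 = 0"
  by (simp add: assoc_stirling2_def)

lemma lambertW_ex1:
  assumes "x > 0"
  shows "\<exists>!y::real. 0 < y \<and> y * exp y = x"
proof -
  have "\<exists>y\<ge>0. y \<le> x \<and> y * exp y = x"
    by (rule IVT') (use assms in \<open>auto intro!: continuous_intros\<close>)
  then obtain y where y: "y \<ge> 0" "y * exp y = x"
    by blast
  have mono: "u * exp u < v * exp v" if "0 < u" "u < v" for u v :: real
    using that by (intro mult_strict_mono) auto
  show ?thesis
  proof (rule ex1I[of _ y])
    show "0 < y \<and> y * exp y = x"
      using y assms by (cases "y = 0") auto
    then show "z = y" if "0 < z \<and> z * exp z = x" for z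
      using that mono[of z y] mono[of y z] by (cases z y rule: linorder_cases) auto
  qed
qed

lemma lambertW_pos: "x > 0 \<Longrightarrow> lambertW x > 0"
  and lambertW_eq: "x > 0 \<Longrightarrow> lambertW x * exp (lambertW x) = x"
  using theI'[OF lambertW_ex1, of x] unfolding lambertW_def by auto

end

theory Submission
  imports Defs "HOL-Complex_Analysis.Complex_Analysis" "HOL-Real_Asymp.Real_Asymp"
begin

text \<open>
  Put \<open>s = L1 - L2 = L1 * (1 - \<tau>)\<close>, so that \<open>\<eta> = 1 / s\<close>, and write the solution of
  \<open>y * exp y = x\<close> as \<open>y = s - L\<tau> + v\<close>. Since \<open>exp (s - L\<tau>) = x / s\<close>, the equation becomes
  \<open>exp (- v) = 1 + \<eta> * (v - L\<tau>)\<close>. With \<open>c = 1 + \<eta>\<close>, \<open>t = L\<tau> * \<eta>\<close> and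
  \<open>g v = exp (- v) - 1 + v\<close> this reads
  \<open>c * v - g v = t\<close>.
  The series to be established is the power series, in \<open>t\<close>, of the solution \<open>v\<close>
  that vanishes at \<open>t = 0\<close>.

  As \<open>g v\<close> starts with a quadratic term, \<open>c * v - g v = v * (c - g v / v)\<close> is formally
  invertible, and Lagrange inversion (\<open>lagrange_inversion\<close>) gives the coefficient of \<open>t ^ m\<close>
  in the inverse as the coefficient of \<open>v ^ (m - 1)\<close> in \<open>(c - g v / v) powr (- m) / m\<close>.
  Expanding this negative power by the binomial series leaves the powers \<open>g v ^ p\<close>, whose
  coefficients are signed 2-associated Stirling subset numbers; this is \<open>fps_inv_nth_Suc\<close>.

  It remains to pass from the formal identity to a numerical one for a fixed \<open>t\<close>, while
  \<open>c\<close> varies with \<open>x\<close>. The coefficients are bounded by \<open>4 ^ (m - 1)\<close>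
  for all \<open>c \<ge> 1\<close> (\<open>abs_lambert_coeff_le\<close>), so the series converges on a disc that is
  independent of \<open>c\<close>. The equation \<open>c * v - g v = t\<close> holds near \<open>t = 0\<close> because it holds
  formally, and throughout the disc by analytic continuation (\<open>lambert_series_solves\<close>).
  Finally \<open>t \<longlonglongrightarrow> 0\<close> as \<open>x\<close> grows, so \<open>t\<close> eventually lies in the disc.
\<close>

section \<open>Lagrange inversion for formal power series\<close>

text \<open>
  A composition is an infinite sum of powers of the inner series, but only finitely many of them
  reach a given coefficient. This lets coefficient extraction commute with that sum.
\<close>

lemma fps_compose_mult_nth:
  fixes a f Q :: "'a :: idom fps"
  assumes "f $ 0 = 0"
  shows "((a oo f) * Q) $ n = (\<Sum>k\<le>n. a $ k * (f ^ k * Q) $ n)"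
proof -
  have coeff: "(a oo f) $ i = (\<Sum>k\<le>n. a $ k * (f ^ k) $ i)" if "i \<le> n" for i
    unfolding fps_compose_nth using that assms
    by (intro sum.mono_neutral_left) (auto simp: startsby_zero_power_prefix)
  have "((a oo f) * Q) $ n = (\<Sum>i=0..n. \<Sum>k\<le>n. a $ k * (f ^ k) $ i * Q $ (n - i))"
    unfolding fps_mult_nth by (intro sum.cong refl) (simp add: coeff sum_distrib_right)
  also have "\<dots> = (\<Sum>k\<le>n. a $ k * (f ^ k * Q) $ n)"
    by (subst sum.swap) (simp add: fps_mult_nth sum_distrib_left mult.assoc)
  finally show ?thesis .
qed

text \<open>
  With \<open>f = X * \<phi>\<close>, this is the residue of \<open>f' / f ^ Suc j\<close>, written without negative powers.
  For \<open>j > 0\<close> it vanishes because \<open>f' / f ^ Suc j\<close> is, up to a factor, the derivative of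
  \<open>1 / f ^ j\<close>.
\<close>

lemma lagrange_residue:
  fixes \<phi> :: "'a :: field_char_0 fps"
  assumes "\<phi> $ 0 \<noteq> 0"
  shows "(inverse \<phi> ^ Suc j * fps_deriv (fps_X * \<phi>)) $ j = (if j = 0 then 1 else 0)"
proof -
  have inv: "inverse \<phi> * \<phi> = 1"
    using assms by (rule inverse_mult_eq_1)
  have "inverse \<phi> ^ Suc j * fps_deriv (fps_X * \<phi>)
        = inverse \<phi> ^ j * (inverse \<phi> * \<phi>) + fps_X * (inverse \<phi> ^ Suc j * fps_deriv \<phi>)"
    by (simp add: algebra_simps)
  then have eq: "inverse \<phi> ^ Suc j * fps_deriv (fps_X * \<phi>)
        = inverse \<phi> ^ j + fps_X * (inverse \<phi> ^ Suc j * fps_deriv \<phi>)"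
    by (simp only: inv mult_1_right)
  show ?thesis
  proof (cases j)
    case 0
    then show ?thesis using assms by (simp only: eq) simp
  next
    case (Suc i)
    have nz: "(of_nat j :: 'a) \<noteq> 0"
      using Suc by (simp del: of_nat_Suc)
    have "fps_deriv (inverse \<phi> ^ j)
          = of_nat j * (- fps_deriv \<phi> * (inverse \<phi>)\<^sup>2) * inverse \<phi> ^ i"
      using Suc assms by (simp add: fps_deriv_power' fps_inverse_deriv del: power_Suc of_nat_Suc)
    also have "\<dots> = - (of_nat j * (inverse \<phi> ^ Suc j * fps_deriv \<phi>))"
      by (simp add: Suc power2_eq_square algebra_simps)
    finally have "fps_deriv (inverse \<phi> ^ j) $ i
          = - (of_nat j * (inverse \<phi> ^ Suc j * fps_deriv \<phi>) $ i)"
      by (simp only: fps_neg_nth fps_mult_of_nat_nth)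
    moreover have "fps_deriv (inverse \<phi> ^ j) $ i = of_nat j * (inverse \<phi> ^ j) $ j"
      using Suc by (simp del: power_Suc of_nat_Suc)
    ultimately have "of_nat j * (inverse \<phi> ^ j) $ j
          = of_nat j * (- ((inverse \<phi> ^ Suc j * fps_deriv \<phi>) $ i))"
      by (simp only: mult_minus_right)
    then have "(inverse \<phi> ^ j) $ j = - ((inverse \<phi> ^ Suc j * fps_deriv \<phi>) $ i)"
      by (simp only: mult_left_cancel[OF nz])
    then show ?thesis
      unfolding eq using Suc by (simp del: power_Suc)
  qed
qed

text \<open>
  Let \<open>H\<close> be the inverse of \<open>f = X * \<phi>\<close>. Differentiating \<open>H (f X) = X\<close> gives
  \<open>1 = (\<Sum>k. H' $ k * f ^ k) * f'\<close>. Multiplying by \<open>1 / f ^ Suc n\<close> and taking residues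
  kills every summand except \<open>k = n\<close>.
\<close>

theorem lagrange_inversion:
  fixes \<phi> :: "'a :: field_char_0 fps"
  assumes "\<phi> $ 0 \<noteq> 0"
  shows "of_nat (Suc n) * fps_inv (fps_X * \<phi>) $ Suc n = (inverse \<phi> ^ Suc n) $ n"
proof -
  define f where "f = fps_X * \<phi>"
  define H where "H = fps_inv f"
  have f0: "f $ 0 = 0" and f1: "f $ 1 \<noteq> 0"
    using assms by (simp_all add: f_def)
  have inv: "inverse \<phi> * \<phi> = 1"
    using assms by (rule inverse_mult_eq_1)
  have one: "(fps_deriv H oo f) * fps_deriv f = 1"
    using fps_compose_deriv[OF f0, of H] fps_inv[OF f0 f1] by (simp add: H_def)
  have residue: "(f ^ k * (inverse \<phi> ^ Suc n * fps_deriv f)) $ n = (if k = n then 1 else 0)"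
    if "k \<le> n" for k
  proof -
    have "f ^ k * (inverse \<phi> ^ Suc n * fps_deriv f)
        = fps_X ^ k * ((inverse \<phi> * \<phi>) ^ k * (inverse \<phi> ^ Suc (n - k) * fps_deriv f))"
      using that by (simp add: f_def power_mult_distrib mult_ac Suc_diff_le
                       flip: power_add power_Suc)
    then have "f ^ k * (inverse \<phi> ^ Suc n * fps_deriv f)
        = fps_X ^ k * (inverse \<phi> ^ Suc (n - k) * fps_deriv (fps_X * \<phi>))"
      by (simp only: inv power_one mult_1_left) (simp only: f_def)
    then have "(f ^ k * (inverse \<phi> ^ Suc n * fps_deriv f)) $ n
        = (inverse \<phi> ^ Suc (n - k) * fps_deriv (fps_X * \<phi>)) $ (n - k)"
      using that by (simp only: fps_X_power_mult_nth) simp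
    then show ?thesis
      using that by (simp only: lagrange_residue[OF assms]) simp
  qed
  have "(inverse \<phi> ^ Suc n) $ n = ((fps_deriv H oo f) * fps_deriv f * inverse \<phi> ^ Suc n) $ n"
    by (simp only: one mult_1_left)
  also have "\<dots> = ((fps_deriv H oo f) * (inverse \<phi> ^ Suc n * fps_deriv f)) $ n"
    by (simp only: mult_ac)
  also have "\<dots> = (\<Sum>k\<le>n. fps_deriv H $ k * (if k = n then 1 else 0))"
    by (simp only: fps_compose_mult_nth[OF f0]) (intro sum.cong refl, simp only: residue atMost_iff)
  also have "\<dots> = of_nat (Suc n) * H $ Suc n"
    by (simp add: mult_delta_right)
  finally show ?thesis
    by (simp add: H_def f_def)
qed

text \<open>The negative binomial series, with a series \<open>A\<close> substituted for the variable.\<close>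

lemma inverse_one_minus_power_nth:
  fixes A :: "'a :: field_char_0 fps"
  assumes "A $ 0 = 0" "m > 0"
  shows "(inverse (1 - A) ^ m) $ n = (\<Sum>p=0..n. of_nat ((m + p - 1) choose p) * (A ^ p) $ n)"
proof -
  define G :: "'a fps" where "G = Abs_fps (\<lambda>k. of_nat ((m + k - 1) choose k))"
  have G: "G = inverse (1 - fps_X) ^ m"
    using one_minus_const_fps_X_neg_power'[OF assms(2), of "1::'a"]
    by (simp add: G_def fps_inverse_power)
  have "G oo A = (inverse (1 - fps_X) oo A) ^ m"
    unfolding G by (rule fps_compose_power[OF assms(1), symmetric])
  also have "inverse (1 - fps_X) oo A = inverse (1 - A)"
    using assms(1) by (subst fps_inverse_compose) (auto simp: fps_compose_sub_distrib)
  finally have "inverse (1 - A) ^ m = G oo A" ..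
  then show ?thesis
    by (simp add: fps_compose_nth G_def)
qed

section \<open>The formal solution and the Stirling numbers\<close>

abbreviation exp_tail :: "real fps" where
  "exp_tail \<equiv> fps_exp 1 - 1 - fps_X"

text \<open>
  The series of \<open>exp (- v) - 1 + v\<close>. Its coefficients are complex because the analytic
  continuation below takes place in the complex plane.
\<close>

definition neg_exp_tail :: "complex fps" where
  "neg_exp_tail = fps_exp (-1) - 1 + fps_X"

lemma neg_exp_tail_power_nth:
  "(neg_exp_tail ^ p) $ n = of_real ((-1) ^ n * (exp_tail ^ p) $ n)"
proof (induction p arbitrary: n)
  case 0
  then show ?case by simp
next
  case (Suc p)
  have base: "neg_exp_tail $ i = of_real ((-1) ^ i * exp_tail $ i)" for i
    by (cases "i = 1") (auto simp: neg_exp_tail_def fps_X_def)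
  have "(neg_exp_tail ^ Suc p) $ n
      = (\<Sum>i=0..n. of_real ((-1) ^ i * exp_tail $ i)
                   * of_real ((-1) ^ (n - i) * (exp_tail ^ p) $ (n - i)))"
    by (simp only: power_Suc fps_mult_nth base Suc)
  also have "\<dots> = (\<Sum>i=0..n. of_real ((-1) ^ n * (exp_tail $ i * (exp_tail ^ p) $ (n - i))))"
  proof (intro sum.cong refl)
    fix i assume "i \<in> {0..n}"
    then have sgn: "(-1) ^ n = (-1) ^ i * ((-1) ^ (n - i) :: real)"
      by (simp flip: power_add)
    show "complex_of_real ((-1) ^ i * exp_tail $ i) * of_real ((-1) ^ (n - i) * (exp_tail ^ p) $ (n - i))
        = of_real ((-1) ^ n * (exp_tail $ i * (exp_tail ^ p) $ (n - i)))"
      unfolding sgn of_real_mult by (simp only: mult_ac)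
  qed
  also have "\<dots> = of_real ((-1) ^ n * (exp_tail ^ Suc p) $ n)"
    by (simp only: power_Suc fps_mult_nth sum_distrib_left of_real_sum)
  finally show ?case .
qed

definition lambert_coeff :: "real \<Rightarrow> nat \<Rightarrow> real" where
  "lambert_coeff c m = 1 / fact m *
     (\<Sum>p = 0..m - 1. (-1) ^ (p + m - 1) * assoc_stirling2 (p + m - 1) p * (1 / c ^ (p + m)))"

text \<open>
  The factorials in the definition of the Stirling numbers combine with \<open>1 / fact m\<close> to binomial
  coefficients, which is the form produced by Lagrange inversion and suited to estimates.
\<close>

lemma lambert_coeff_Suc:
  "lambert_coeff c (Suc n) = 1 / real (Suc n) *
     (\<Sum>p = 0..n. real ((n + p) choose p) * ((-1) ^ (n + p) * (exp_tail ^ p) $ (n + p) / c ^ (Suc n + p)))"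
proof -
  have "1 / fact (Suc n) * ((-1) ^ (p + n) * assoc_stirling2 (p + n) p * (1 / c ^ (p + Suc n)))
      = 1 / real (Suc n) * (real ((n + p) choose p) * ((-1) ^ (n + p) * (exp_tail ^ p) $ (n + p) / c ^ (Suc n + p)))"
    for p
  proof -
    have "real ((n + p) choose p) = fact (n + p) / (fact p * fact n)"
      by (simp add: binomial_fact)
    then show ?thesis
      by (simp add: assoc_stirling2_def add.commute[of p n] mult_ac del: power_Suc of_nat_Suc)
  qed
  then show ?thesis
    by (simp add: lambert_coeff_def sum_distrib_left del: power_Suc of_nat_Suc fact_Suc)
qed

text \<open>
  Lagrange inversion for \<open>\<phi> = c * (1 - A)\<close>, where \<open>A = g v / (c * v)\<close> for
  \<open>g v = exp (- v) - 1 + v\<close>.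
\<close>

lemma fps_inv_nth_Suc:
  fixes c :: real
  assumes "c \<noteq> 0"
  shows "fps_inv (fps_const (of_real c) * fps_X - neg_exp_tail) $ Suc n = of_real (lambert_coeff c (Suc n))"
proof -
  define K where "K = fps_shift 1 neg_exp_tail"
  define A where "A = fps_const (of_real (1 / c)) * K"
  define \<phi> where "\<phi> = fps_const (of_real c) * (1 - A)"
  have K: "neg_exp_tail = fps_X * K" and K0: "K $ 0 = 0"
    unfolding K_def by (auto simp: neg_exp_tail_def fps_eq_iff)
  have A0: "A $ 0 = 0"
    by (simp add: A_def K0)
  have cA: "fps_const (of_real c) * A = K"
    using assms unfolding A_def mult.assoc[symmetric] fps_const_mult by simp
  have f: "fps_const (of_real c) * fps_X - neg_exp_tail = fps_X * \<phi>"
    unfolding K \<phi>_def right_diff_distrib cA by (simp add: algebra_simps)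
  have \<phi>0: "\<phi> $ 0 \<noteq> 0"
    using assms by (simp add: \<phi>_def A0)
  have "inverse \<phi> ^ Suc n = fps_const (of_real (1 / c ^ Suc n)) * inverse (1 - A) ^ Suc n"
    unfolding \<phi>_def
    by (simp add: fps_inverse_mult power_mult_distrib fps_const_inverse fps_const_power
             divide_inverse power_inverse del: power_Suc)
  moreover have "(A ^ p) $ n = of_real ((-1) ^ (n + p) * (exp_tail ^ p) $ (n + p) / c ^ p)" for p
  proof -
    have "(K ^ p) $ n = (neg_exp_tail ^ p) $ (n + p)"
      unfolding K power_mult_distrib by (simp add: fps_X_power_mult_nth)
    then show ?thesis
      by (simp add: A_def power_mult_distrib fps_const_power neg_exp_tail_power_nth power_divide)
  qed
  ultimately have "(inverse \<phi> ^ Suc n) $ n = of_real (\<Sum>p=0..n. real ((n + p) choose p) *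
      ((-1) ^ (n + p) * (exp_tail ^ p) $ (n + p) / c ^ (Suc n + p)))"
    unfolding power_add[of c "Suc n"]
    by (simp add: inverse_one_minus_power_nth[OF A0] sum_distrib_left mult_ac del: power_Suc)
  then show ?thesis
    using lagrange_inversion[OF \<phi>0, of n] unfolding f lambert_coeff_Suc
    by (simp add: field_simps del: power_Suc of_nat_Suc)
qed

section \<open>Convergence and analytic continuation\<close>

text \<open>
  The coefficients are nonnegative and sum to the value \<open>(exp 1 - 2) ^ p\<close> of the series at
  \<open>1\<close>, and \<open>0 \<le> exp 1 - 2 \<le> 1\<close>.
\<close>

lemma exp_tail_power_nth_bounds:
  "0 \<le> (exp_tail ^ p) $ n" "(exp_tail ^ p) $ n \<le> 1"
proof -
  have base: "0 \<le> exp_tail $ i" for i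
    by (cases "i = 1") (auto simp: fps_X_def)
  show nonneg: "0 \<le> (exp_tail ^ p) $ n" for n
    by (induction p arbitrary: n) (auto simp: fps_mult_nth intro!: sum_nonneg mult_nonneg_nonneg base)
  have rad1: "fps_conv_radius (fps_exp (1::real) - 1) = \<infinity>"
    using fps_conv_radius_diff[of "fps_exp (1::real)" 1] by simp
  have rad: "fps_conv_radius exp_tail = \<infinity>"
    using fps_conv_radius_diff[of "fps_exp (1::real) - 1" fps_X] rad1 by simp
  have radp: "fps_conv_radius (exp_tail ^ p) = \<infinity>"
    using fps_conv_radius_power[of exp_tail p] rad by simp
  have "eval_fps exp_tail 1 = exp 1 - 2"
    using rad1 by (simp add: eval_fps_diff)
  then have "eval_fps (exp_tail ^ p) 1 = (exp 1 - 2) ^ p"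
    by (subst eval_fps_power) (auto simp: rad)
  moreover have "(\<lambda>n. (exp_tail ^ p) $ n * 1 ^ n) sums eval_fps (exp_tail ^ p) 1"
    by (rule sums_eval_fps) (simp add: radp)
  ultimately have "(\<lambda>n. (exp_tail ^ p) $ n) sums (exp 1 - 2) ^ p"
    by simp
  then have "(exp_tail ^ p) $ n \<le> (exp 1 - 2) ^ p"
    using sum_le_suminf[of "\<lambda>n. (exp_tail ^ p) $ n" "{n}"] nonneg
    by (auto simp: sums_iff)
  also have "\<dots> \<le> 1"
    using exp_le exp_ge_add_one_self[of "1::real"] by (intro power_le_one) auto
  finally show "(exp_tail ^ p) $ n \<le> 1" .
qed

text \<open>
  Each of the \<open>n + 1\<close> summands is at most \<open>(n + p) choose p \<le> 2 ^ (2 * n)\<close>, and the prefactor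
  \<open>1 / Suc n\<close> absorbs their number. What matters is that the bound does not depend on \<open>c\<close>.
\<close>

lemma abs_lambert_coeff_le:
  assumes "c \<ge> 1"
  shows "\<bar>lambert_coeff c (Suc n)\<bar> \<le> 4 ^ n"
proof -
  have "\<bar>\<Sum>p = 0..n. real ((n + p) choose p) * ((-1) ^ (n + p) * (exp_tail ^ p) $ (n + p) / c ^ (Suc n + p))\<bar>
      \<le> (\<Sum>p = 0..n. 4 ^ n)"
  proof (rule order.trans[OF sum_abs], rule sum_mono)
    fix p assume p: "p \<in> {0..n}"
    have "real ((n + p) choose p) \<le> 2 ^ (n + p)"
      using binomial_le_pow2[of "n + p" p] by (metis of_nat_le_iff of_nat_numeral of_nat_power)
    also have "\<dots> \<le> 2 ^ (n + n)"
      using p by (intro power_increasing) auto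
    also have "\<dots> = (4::real) ^ n"
      by (simp add: power_add flip: power_mult_distrib)
    finally have binom: "real ((n + p) choose p) \<le> 4 ^ n" .
    have "\<bar>(-1) ^ (n + p) * (exp_tail ^ p) $ (n + p) / c ^ (Suc n + p)\<bar>
        = (exp_tail ^ p) $ (n + p) / c ^ (Suc n + p)"
      using exp_tail_power_nth_bounds(1)[of p "n + p"] assms
      by (simp add: abs_mult power_abs del: power_Suc)
    also have "\<dots> \<le> 1 / 1"
      using exp_tail_power_nth_bounds[of p "n + p"] assms by (intro frac_le one_le_power) auto
    finally have "\<bar>(-1) ^ (n + p) * (exp_tail ^ p) $ (n + p) / c ^ (Suc n + p)\<bar> \<le> 1"
      by simp
    with binom show "\<bar>real ((n + p) choose p) * ((-1) ^ (n + p) * (exp_tail ^ p) $ (n + p) / c ^ (Suc n + p))\<bar> \<le> 4 ^ n"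
      unfolding abs_mult[of "real _"]
      using mult_mono[OF binom, of "\<bar>(-1) ^ (n + p) * (exp_tail ^ p) $ (n + p) / c ^ (Suc n + p)\<bar>" 1]
      by (simp only: abs_of_nat abs_ge_zero mult_1_right zero_le_power zero_le_numeral)
  qed
  then show ?thesis
    unfolding lambert_coeff_Suc by (simp add: abs_mult field_simps)
qed

text \<open>
  The coefficient bound gives radius at least \<open>1 / 4\<close>. At the smaller radius \<open>1 / 8\<close> a single
  comparison with a geometric series suffices.
\<close>

lemma fps_inv_conv_radius:
  fixes c :: real
  assumes "c \<ge> 1"
  shows "fps_conv_radius (fps_inv (fps_const (of_real c) * fps_X - neg_exp_tail)) \<ge> ereal (1 / 8)"
proof -
  let ?H = "fps_inv (fps_const (complex_of_real c) * fps_X - neg_exp_tail)"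
  have "summable (\<lambda>n. ?H $ Suc n * (1 / 8) ^ Suc n)"
  proof (rule summable_comparison_test)
    show "summable (\<lambda>n. (1 / 2 :: real) ^ n)"
      by (rule summable_geometric) simp
    have "norm (?H $ Suc n * (1 / 8) ^ Suc n) \<le> (1 / 2) ^ n" for n
    proof -
      have "norm (?H $ Suc n * (1 / 8) ^ Suc n) = \<bar>lambert_coeff c (Suc n)\<bar> * (1 / 8) ^ Suc n"
        using assms by (subst fps_inv_nth_Suc) (auto simp: norm_mult norm_power norm_divide simp del: power_Suc)
      also have "\<dots> \<le> 4 ^ n * (1 / 8) ^ Suc n"
        by (intro mult_right_mono abs_lambert_coeff_le assms) auto
      also have "\<dots> = (1 / 8) * (1 / 2) ^ n"
        by (simp flip: power_mult_distrib)
      also have "\<dots> \<le> (1 / 2) ^ n"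
        by simp
      finally show ?thesis .
    qed
    then show "\<exists>N. \<forall>n\<ge>N. norm (?H $ Suc n * (1 / 8) ^ Suc n) \<le> (1 / 2) ^ n"
      by blast
  qed
  then have "summable (\<lambda>n. ?H $ n * (1 / 8) ^ n)"
    by (subst (asm) summable_Suc_iff)
  from conv_radius_geI[OF this] show ?thesis
    by (simp add: fps_conv_radius_def norm_divide)
qed

text \<open>
  The formal composition of two series describes the composite function a priori only near \<open>0\<close>,
  on a disc that might shrink as \<open>c\<close> varies. Both sides of the equation are holomorphic on the disc
  of radius \<open>1 / 8\<close>, so the identity theorem carries the equation to all of it.
\<close>

lemma lambert_series_solves:
  fixes c t :: real
  assumes c: "c \<ge> 1" and t: "\<bar>t\<bar> < 1 / 8"
  obtains v where "(\<lambda>n. lambert_coeff c (Suc n) * t ^ Suc n) sums v"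
    and "exp (- v) = 1 + (c - 1) * v - t"
proof -
  define F where "F = fps_const (complex_of_real c) * fps_X - neg_exp_tail"
  define H where "H = fps_inv F"
  have F0: "F $ 0 = 0" and F1: "F $ 1 \<noteq> 0"
    using c by (auto simp: F_def neg_exp_tail_def)
  have H0: "H $ 0 = 0"
    by (simp add: H_def fps_inv_def)
  have rad: "fps_conv_radius H \<ge> ereal (1 / 8)"
    using fps_inv_conv_radius[OF c] by (simp add: H_def F_def)
  have sub: "ball (0::complex) (1 / 8) \<subseteq> eball 0 (fps_conv_radius H)"
  proof
    fix z :: complex assume "z \<in> ball 0 (1 / 8)"
    then have "ereal (dist 0 z) < ereal (1 / 8)"
      by simp
    then show "z \<in> eball 0 (fps_conv_radius H)"
      using rad by (simp only: in_eball_iff less_le_trans)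
  qed
  have radpos: "fps_conv_radius H > 0"
    by (rule less_le_trans[OF _ rad]) (simp add: zero_ereal_def)
  \<comment> \<open>\<open>f\<close> is the entire function with Taylor series \<open>F\<close>, and \<open>F oo H = fps_X\<close> will say that
    \<open>f\<close> after the sum of \<open>H\<close> is the identity.\<close>
  define f where "f = (\<lambda>z::complex. of_real c * z - (exp (- z) - 1 + z))"
  have "f has_fps_expansion F"
    unfolding f_def F_def neg_exp_tail_def by (intro fps_expansion_intros)
  then have "(f \<circ> eval_fps H) has_fps_expansion (F oo H)"
    by (intro has_fps_expansion_compose eval_fps_has_fps_expansion radpos H0)
  also have "F oo H = fps_X"
    unfolding H_def by (rule fps_inv_right[OF F0 F1])
  finally have expn: "(f \<circ> eval_fps H) has_fps_expansion fps_X" .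
  have "(f \<circ> eval_fps H) holomorphic_on ball 0 (1 / 8)"
    unfolding f_def o_def by (intro holomorphic_intros sub)
  from has_fps_expansion_imp_eval_fps_eq[OF expn _ this, of "of_real t"]
  have eq: "f (eval_fps H (of_real t)) = of_real t"
    using t by simp
  have "ereal (norm (complex_of_real t)) < fps_conv_radius H"
    using t by (intro less_le_trans[OF _ rad]) simp
  from sums_eval_fps[OF this]
  have "(\<lambda>n. H $ Suc n * of_real t ^ Suc n) sums eval_fps H (of_real t)"
    using sums_Suc_iff[of "\<lambda>n. H $ n * complex_of_real t ^ n"] by (simp add: H0 del: power_Suc)
  moreover have "H $ Suc n * of_real t ^ Suc n
      = of_real (lambert_coeff c (Suc n) * t ^ Suc n)" for n
    using c unfolding H_def F_def by (subst fps_inv_nth_Suc) (auto simp del: power_Suc)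
  ultimately have sums: "(\<lambda>n. complex_of_real (lambert_coeff c (Suc n) * t ^ Suc n)) sums eval_fps H (of_real t)"
    by (simp del: power_Suc of_real_mult of_real_power)
  define v where "v = Re (eval_fps H (of_real t))"
  have vs: "(\<lambda>n. lambert_coeff c (Suc n) * t ^ Suc n) sums v"
    using sums_Re[OF sums] by (simp add: v_def del: power_Suc of_real_mult of_real_power)
  then have "eval_fps H (of_real t) = of_real v"
    using sums_unique2[OF sums] sums_of_real by blast
  with eq have "complex_of_real (c * v - (exp (- v) - 1 + v)) = of_real t"
    by (simp add: f_def exp_of_real flip: of_real_minus)
  then have "exp (- v) = 1 + (c - 1) * v - t"
    unfolding of_real_eq_iff by (simp add: algebra_simps)
  with vs show ?thesis
    by (rule that)
qed

section \<open>The expansion of the Lambert function\<close>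

lemma lambertW_eqI:
  assumes "y > 0" "y * exp y = x"
  shows "lambertW x = y"
  unfolding lambertW_def
proof (rule the1_equality)
  show "\<exists>!y. 0 < y \<and> y * exp y = x"
    using assms by (intro lambertW_ex1) auto
qed (use assms in simp)

text \<open>
  The hypothesis on \<open>v\<close> says \<open>s - \<mu> + v = s * exp (- v)\<close>. This shows positivity, and it makes the factors \<open>exp v\<close> and \<open>exp (- v)\<close> cancel in \<open>y * exp y\<close>.
\<close>

lemma lambertW_eq_log_shift:
  fixes x \<mu> v :: real
  defines "s \<equiv> ln x - ln (ln x)"
  assumes x: "x > 1" and s: "s > 0"
    and \<mu>: "\<mu> = ln (s / ln x)"
    and v: "exp (- v) = 1 + (v - \<mu>) / s"
  shows "lambertW x = s - \<mu> + v"
proof (rule lambertW_eqI)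
  have L: "ln x > 0"
    using x by simp
  have y: "s - \<mu> + v = s * exp (- v)"
    using s by (simp add: v field_simps)
  show "s - \<mu> + v > 0"
    unfolding y using s by simp
  have "exp (s - \<mu> + v) = exp (ln x) / exp (ln (ln x)) / exp \<mu> * exp v"
    by (simp only: s_def exp_add exp_diff)
  also have "\<dots> = x * exp v / s"
    using x L s by (simp add: \<mu> field_simps)
  finally show "(s - \<mu> + v) * exp (s - \<mu> + v) = x"
    using s unfolding y by (simp add: exp_minus)
qed

theorem theorem5:
  "\<forall>\<^sub>F x :: real in at_top.
     (let L1 = ln x;
          L2 = ln (ln x);
          \<sigma> = 1 / L1;
          \<tau> = L2 / L1;
          L\<tau> = ln (1 - \<tau>);
          \<eta> = \<sigma> / (1 - \<tau>);
          a = (\<lambda>m::nat. 1 / fact m * L\<tau> ^ m * \<eta> ^ m *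
                (\<Sum>p = 0..m - 1. (-1) ^ (p + m - 1) * assoc_stirling2 (p + m - 1) p *
                   (1 / (1 + \<eta>) ^ (p + m))))
      in summable (\<lambda>k. a (Suc k)) \<and>
         lambertW x = L1 - L2 - L\<tau> + (\<Sum>k. a (Suc k)))"
proof -
  have "((\<lambda>x::real. ln (1 - ln (ln x) / ln x) * (1 / ln x / (1 - ln (ln x) / ln x))) \<longlongrightarrow> 0) at_top"
    by real_asymp
  then have small: "\<forall>\<^sub>F x :: real in at_top.
      \<bar>ln (1 - ln (ln x) / ln x) * (1 / ln x / (1 - ln (ln x) / ln x))\<bar> < 1 / 8"
    by (intro order_tendstoD(2)[OF tendsto_rabs_zero]) simp_all
  have "\<forall>\<^sub>F x :: real in at_top. ln (ln x) < ln x"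
    by real_asymp
  with small eventually_gt_at_top[of 1] show ?thesis
  proof eventually_elim
    case (elim x)
    define \<tau> where "\<tau> = ln (ln x) / ln x"
    define L\<tau> where "L\<tau> = ln (1 - \<tau>)"
    define \<eta> where "\<eta> = 1 / ln x / (1 - \<tau>)"
    define s where "s = ln x - ln (ln x)"
    have L: "ln x > 0" and s: "s > 0"
      using elim by (auto simp: s_def)
    have \<tau>: "1 - \<tau> = s / ln x"
      using L by (simp add: \<tau>_def s_def field_simps)
    have \<eta>: "\<eta> = 1 / s"
      using L by (simp add: \<eta>_def \<tau>)
    have "1 + \<eta> \<ge> 1"
      using s by (simp add: \<eta>)
    moreover have "\<bar>L\<tau> * \<eta>\<bar> < 1 / 8"
      unfolding L\<tau>_def \<eta>_def \<tau>_def by (rule elim(1))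
    ultimately obtain v where v: "(\<lambda>n. lambert_coeff (1 + \<eta>) (Suc n) * (L\<tau> * \<eta>) ^ Suc n) sums v"
        "exp (- v) = 1 + (1 + \<eta> - 1) * v - L\<tau> * \<eta>"
      by (rule lambert_series_solves)
    have "lambertW x = ln x - ln (ln x) - L\<tau> + v"
      unfolding s_def[symmetric]
    proof (unfold s_def, rule lambertW_eq_log_shift)
      show "exp (- v) = 1 + (v - L\<tau>) / (ln x - ln (ln x))"
        unfolding v(2) \<eta> s_def by (simp add: diff_divide_distrib)
    qed (use elim s in \<open>auto simp: L\<tau>_def \<tau> s_def\<close>)
    moreover have "(\<lambda>k. 1 / fact (Suc k) * L\<tau> ^ Suc k * \<eta> ^ Suc k *
                (\<Sum>p = 0..Suc k - 1. (-1) ^ (p + Suc k - 1) * assoc_stirling2 (p + Suc k - 1) p *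
                   (1 / (1 + \<eta>) ^ (p + Suc k)))) sums v"
      using v(1) unfolding lambert_coeff_def power_mult_distrib by (simp only: mult_ac)
    ultimately show ?case
      unfolding Let_def \<tau>_def[symmetric] L\<tau>_def[symmetric] \<eta>_def[symmetric]
      by (simp only: sums_iff)
  qed
qed

end
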